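(* For every integer $n\ge 1$, $$\mathrm{pf}_n(231,321)=\frac{\binom{3n}{n}}{2n+1}.$$
   Context: A Dyck path of semilength $n$ is a lattice path from $(0,0)$ to $(n,n)$ consisting of $n$ north steps $N=(0,1)$ and $n$ east steps $E=(1,0)$ that never goes below the line $y=x$. A parking function of size $n$ is a Dyck path of semilength $n$ whose $n$ north steps are labeled bijectively by $\{1,\dots,n\}$ so that whenever two north steps are consecutive in the path (one immediately following the other), the label of the later one is larger. For a parking function $p$ of size $n$, $\phi(p)$ is the permutation of $\{1,\dots,n\}$ (in one-line notation) obtained by reading the labels of the north steps in the order they occur along the path. A permutation $\pi$ of $\{1,\dots,n\}$ contains a permutation $\rho$ of $\{1,\dots,m\}$ if there are indices $1\le i_1<\cdots<i_m\le n$ such that $\pi_{i_a}\le\pi_{i_b}$ if and only if $\rho_a\le\rho_b$; otherwise $\pi$ avoids $\rho$. For permutations $\rho_1,\dots,\rho_r$, $\mathrm{pf}_n(\rho_1,\dots,\rho_r)$ denotes the number of parking functions $p$ of size $n$ such that $\phi(p)$ avoids each of $\rho_1,\dots,\rho_r$. *)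

theory Defs
  imports Complex_Main "HOL-Combinatorics.Multiset_Permutations"
begin

datatype step = North | East

fun move :: "step \<Rightarrow> nat \<times> nat \<Rightarrow> nat \<times> nat" where
  "move North (x, y) = (x, Suc y)"
| "move East (x, y) = (Suc x, y)"

definition endpoint :: "step list \<Rightarrow> nat \<times> nat" where
  "endpoint w = fold move w (0, 0)"

text \<open>Steps are vertical or horizontal units, so a path stays weakly above the diagonal iff
  all its lattice points do; these are the endpoints of its prefixes.\<close>

definition dyck_path :: "nat \<Rightarrow> step list \<Rightarrow> bool" where
  "dyck_path n w \<longleftrightarrow>
     endpoint w = (n, n) \<and>
     (\<forall>k \<le> length w. fst (endpoint (take k w)) \<le> snd (endpoint (take k w)))"

datatype lstep = LNorth nat | LEast

primrec step_of :: "lstep \<Rightarrow> step" where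
  "step_of (LNorth a) = North"
| "step_of LEast = East"

text \<open>The permutation read off from a labelled path, as a list in one-line notation.\<close>

primrec phi :: "lstep list \<Rightarrow> nat list" where
  "phi [] = []"
| "phi (s # p) = (case s of LNorth a \<Rightarrow> a # phi p | LEast \<Rightarrow> phi p)"

text \<open>Bijectivity of the labelling means that the word of labels lists every element of
  \<open>{1..n}\<close> exactly once, which is membership in \<^const>\<open>permutations_of_set\<close>.\<close>

definition parking_function :: "nat \<Rightarrow> lstep list \<Rightarrow> bool" where
  "parking_function n p \<longleftrightarrow>
     dyck_path n (map step_of p) \<and>
     phi p \<in> permutations_of_set {1..n} \<and>
     (\<forall>i a b. Suc i < length p \<longrightarrow> p ! i = LNorth a \<longrightarrow> p ! Suc i = LNorth b \<longrightarrow> a < b)"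

text \<open>Permutations are lists in one-line notation, with positions counted from 0.\<close>

definition contains_pattern :: "nat list \<Rightarrow> nat list \<Rightarrow> bool" where
  "contains_pattern \<pi> \<rho> \<longleftrightarrow>
     (\<exists>f :: nat \<Rightarrow> nat. strict_mono_on {..<length \<rho>} f \<and> f ` {..<length \<rho>} \<subseteq> {..<length \<pi>} \<and>
        (\<forall>a < length \<rho>. \<forall>b < length \<rho>. \<pi> ! f a \<le> \<pi> ! f b \<longleftrightarrow> \<rho> ! a \<le> \<rho> ! b))"

definition avoids :: "nat list \<Rightarrow> nat list \<Rightarrow> bool" where
  "avoids \<pi> \<rho> \<longleftrightarrow> \<not> contains_pattern \<pi> \<rho>"

definition pf :: "nat \<Rightarrow> nat list set \<Rightarrow> nat" where
  "pf n R = card {p. parking_function n p \<and> (\<forall>\<rho>\<in>R. avoids (phi p) \<rho>)}"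

text \<open>The set counted by \<open>pf\<close> is finite, so its cardinality is the genuine one.\<close>

lemma endpoint_sum: "fst (fold move w z) + snd (fold move w z) = fst z + snd z + length w"
proof (induction w arbitrary: z)
  case (Cons s w)
  then show ?case by (cases s; cases z) simp_all
qed simp

lemma set_phi: "a \<in> set (phi p) \<longleftrightarrow> LNorth a \<in> set p"
  by (induction p) (auto split: lstep.splits)

lemma finite_parking_functions: "finite {p. parking_function n p}"
proof (rule finite_subset)
  show "{p. parking_function n p} \<subseteq>
      {p. set p \<subseteq> insert LEast (LNorth ` {1..n}) \<and> length p = 2 * n}"
  proof safe
    fix p assume p: "parking_function n p"
    then have "fold move (map step_of p) (0, 0) = (n, n)"
      by (simp add: parking_function_def dyck_path_def endpoint_def)
    then show "length p = 2 * n"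
      using endpoint_sum[of "map step_of p" "(0, 0)"] by simp
    fix s assume s: "s \<in> set p" "s \<notin> LNorth ` {1..n}"
    have labels: "set (phi p) = {1..n}"
      using p by (auto simp: parking_function_def permutations_of_set_def)
    show "s = LEast"
    proof (cases s)
      case (LNorth a)
      then have "a \<in> {1..n}" using s(1) labels set_phi by blast
      then show ?thesis using s(2) LNorth by blast
    qed
  qed
  show "finite {p. set p \<subseteq> insert LEast (LNorth ` {1..n}) \<and> length p = 2 * n}"
    by (rule finite_lists_length_eq) simp
qed

end

theory Submission
  imports Defs
begin

text \<open>A permutation avoids 231 and 321 iff no entry has two larger entries before it. Such a
  permutation of an interval with minimum \<open>c\<close> has \<open>c\<close> in first or second place, and deleting
  \<open>c\<close> leaves such a permutation of the remaining interval. Reading a labelled path from the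
  left, one therefore only has to remember the height above the diagonal and whether some label
  larger than the least unread one has already been read. Counting the possible completions in
  these two situations gives two mutually recursive arrays; suitable sums of neighbouring entries
  are the coefficients of the powers of the series \<open>T = 1 + x T\<^sup>3\<close>, that is, ballot numbers.\<close>

section \<open>Coefficients of the powers of \<open>T = 1 + x T\<^sup>3\<close>\<close>

text \<open>\<open>raney k m\<close> is the coefficient of \<open>x\<^sup>m\<close> in \<open>T\<^sup>k\<close>; the recursion is
  \<open>T\<^sup>k\<^sup>+\<^sup>1 = T\<^sup>k + x T\<^sup>k\<^sup>+\<^sup>3\<close>.\<close>

fun raney :: "nat \<Rightarrow> nat \<Rightarrow> nat" where
  "raney k 0 = 1"
| "raney 0 (Suc m) = 0"
| "raney (Suc k) (Suc m) = raney k (Suc m) + raney (k + 3) m"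

declare raney.simps(3) [simp del]

text \<open>Consecutive binomials have ratio \<open>(2 * m + 2) / (m + 1) = 2\<close> here. This
  makes the closed form below vanish one step before its range, matching
  \<open>raney 0 (Suc m) = 0\<close>.\<close>

lemma choose_Suc_double: "(3 * m + 2) choose Suc m = 2 * ((3 * m + 2) choose m)"
proof -
  have "Suc m * ((3 * m + 2) choose Suc m) = (3 * m + 2 - m) * ((3 * m + 2) choose m)"
    by (metis binomial_absorb_comp binomial_absorption)
  also have "\<dots> = Suc m * (2 * ((3 * m + 2) choose m))"
    by (simp add: algebra_simps del: binomial_Suc_Suc)
  finally show ?thesis
    by (simp only: mult_cancel1) simp
qed

text \<open>A difference of binomials, written additively to avoid truncated subtraction. By
  Pascal's rule it obeys the recursion of \<open>raney\<close>: both terms on the right of the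
  recursion have the same upper index \<open>N\<close>.\<close>

lemma raney_closed_form:
  "raney (Suc k) (Suc m) + 2 * ((3 * m + k + 3) choose m) = (3 * m + k + 3) choose Suc m"
proof (induction m arbitrary: k)
  case 0
  show ?case by (induction k) (simp_all add: raney.simps(3))
next
  case (Suc m)
  note IH = Suc.IH
  show ?case
  proof (induction k)
    case 0
    define N where "N = 3 * Suc m + 2"
    have N: "3 * Suc m + 0 + 3 = Suc N" "3 * m + 2 + 3 = N"
      by (simp_all add: N_def)
    have "raney (Suc 0) (Suc (Suc m)) = raney (Suc 2) (Suc m)"
      by (simp add: raney.simps(3) numeral_eq_Suc)
    then show ?case
      using IH[of 2] choose_Suc_double[of "Suc m", folded N_def]
      unfolding N binomial_Suc_Suc by presburger
  next
    case (Suc k)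
    define N where "N = 3 * Suc m + k + 3"
    have N: "3 * Suc m + Suc k + 3 = Suc N" "3 * m + (k + 3) + 3 = N"
      by (simp_all add: N_def)
    have "raney (Suc (Suc k)) (Suc (Suc m)) = raney (Suc k) (Suc (Suc m)) + raney (Suc (k + 3)) (Suc m)"
      by (simp add: raney.simps(3) numeral_eq_Suc)
    then show ?case
      using Suc.IH[folded N_def] IH[of "k + 3"]
      unfolding N binomial_Suc_Suc by presburger
  qed
qed

text \<open>For \<open>n > 0\<close>, absorption turns the subtracted binomial of the closed form,
  times \<open>2 * n + 1\<close>, into \<open>n * ((3 * n) choose n)\<close>; what remains is the
  factor \<open>2 * n + 1 - 2 * n = 1\<close>.\<close>

lemma raney_1: "(2 * n + 1) * raney 1 n = (3 * n) choose n"
proof (cases n)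
  case (Suc m)
  have "raney 1 n + 2 * ((3 * n) choose m) = (3 * n) choose n"
    using raney_closed_form[of 0 m] by (simp add: Suc add.commute del: binomial_Suc_Suc)
  then have "(2 * n + 1) * raney 1 n + 2 * ((2 * n + 1) * ((3 * n) choose m))
      = (2 * n + 1) * ((3 * n) choose n)"
    by (metis add_mult_distrib2 mult.left_commute)
  moreover have "(2 * n + 1) * ((3 * n) choose m) = n * ((3 * n) choose n)"
  proof -
    have "(3 * n - m) * ((3 * n) choose m) = Suc m * ((3 * n) choose Suc m)"
      by (metis binomial_absorb_comp binomial_absorption)
    moreover have "3 * n - m = 2 * n + 1"
      by (simp add: Suc)
    ultimately show ?thesis
      by (simp only: Suc)
  qed
  ultimately show ?thesis
    by (simp add: algebra_simps)
qed simp

section \<open>Permutations avoiding 231 and 321\<close>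

definition no_two_larger_before :: "nat list \<Rightarrow> bool" where
  "no_two_larger_before \<pi> \<longleftrightarrow>
     (\<forall>i j k. i < j \<longrightarrow> j < k \<longrightarrow> k < length \<pi> \<longrightarrow> \<pi> ! k < \<pi> ! i \<longrightarrow> \<not> \<pi> ! k < \<pi> ! j)"

lemma contains_pattern_3:
  "contains_pattern \<pi> [a, b, c] \<longleftrightarrow>
    (\<exists>i j k. i < j \<and> j < k \<and> k < length \<pi> \<and>
      (\<pi> ! i \<le> \<pi> ! j \<longleftrightarrow> a \<le> b) \<and> (\<pi> ! j \<le> \<pi> ! i \<longleftrightarrow> b \<le> a) \<and>
      (\<pi> ! i \<le> \<pi> ! k \<longleftrightarrow> a \<le> c) \<and> (\<pi> ! k \<le> \<pi> ! i \<longleftrightarrow> c \<le> a) \<and>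
      (\<pi> ! j \<le> \<pi> ! k \<longleftrightarrow> b \<le> c) \<and> (\<pi> ! k \<le> \<pi> ! j \<longleftrightarrow> c \<le> b))"
    (is "?L \<longleftrightarrow> (\<exists>i j k. ?R i j k)")
proof -
  have all_less: "(\<forall>x < length [a, b, c]. P x) \<longleftrightarrow> P 0 \<and> P 1 \<and> P 2" for P
    by (auto simp: less_Suc_eq numeral_2_eq_2)
  have mono: "strict_mono_on {..<length [a, b, c]} f \<longleftrightarrow> f 0 < f 1 \<and> f 1 < f 2" for f :: "nat \<Rightarrow> nat"
    by (auto simp: strict_mono_on_def less_Suc_eq numeral_2_eq_2)
  have range: "f ` {..<length [a, b, c]} \<subseteq> {..<length \<pi>} \<longleftrightarrow>
      f 0 < length \<pi> \<and> f 1 < length \<pi> \<and> f 2 < length \<pi>" for f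
    by (auto simp: less_Suc_eq numeral_2_eq_2)
  have "?L \<longleftrightarrow> (\<exists>f :: nat \<Rightarrow> nat. ?R (f 0) (f 1) (f 2))"
    unfolding contains_pattern_def mono range all_less by auto
  also have "\<dots> \<longleftrightarrow> (\<exists>i j k. ?R i j k)"
  proof
    assume "\<exists>i j k. ?R i j k"
    then obtain i j k where "?R i j k"
      by blast
    then show "\<exists>f :: nat \<Rightarrow> nat. ?R (f 0) (f 1) (f 2)"
      \<comment> \<open>Only the values at 0, 1 and 2 matter, so list indexing serves as the
        embedding.\<close>
      by (intro exI[of _ "(!) [i, j, k]"]) simp
  qed blast
  finally show ?thesis .
qed

text \<open>The two patterns differ only in the order of their first two entries, and distinctness
  excludes a tie there. Together they forbid just a last entry below both others.\<close>

lemma avoids_231_321_iff: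
  assumes "distinct \<pi>"
  shows "avoids \<pi> [2, 3, 1] \<and> avoids \<pi> [3, 2, 1] \<longleftrightarrow> no_two_larger_before \<pi>"
proof -
  have neq: "\<pi> ! i \<noteq> \<pi> ! j" if "i < j" "j < k" "k < length \<pi>" for i j k
    using assms that by (simp add: nth_eq_iff_index_eq)
  have "contains_pattern \<pi> [2, 3, 1] \<or> contains_pattern \<pi> [3, 2, 1] \<longleftrightarrow>
    (\<exists>i j k. i < j \<and> j < k \<and> k < length \<pi> \<and> \<pi> ! k < \<pi> ! i \<and> \<pi> ! k < \<pi> ! j)"
    (is "_ \<longleftrightarrow> ?R")
  proof
    assume ?R
    then obtain i j k where *: "i < j" "j < k" "k < length \<pi>" "\<pi> ! k < \<pi> ! i" "\<pi> ! k < \<pi> ! j"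
      by blast
    with neq consider "\<pi> ! i < \<pi> ! j" | "\<pi> ! j < \<pi> ! i"
      using linorder_neqE_nat by blast
    then show "contains_pattern \<pi> [2, 3, 1] \<or> contains_pattern \<pi> [3, 2, 1]"
    proof cases
      case 1
      then have "contains_pattern \<pi> [2, 3, 1]"
        unfolding contains_pattern_3 using *
        by (intro exI[of _ i] exI[of _ j] exI[of _ k]) simp
      then show ?thesis ..
    next
      case 2
      then have "contains_pattern \<pi> [3, 2, 1]"
        unfolding contains_pattern_3 using *
        by (intro exI[of _ i] exI[of _ j] exI[of _ k]) simp
      then show ?thesis ..
    qed
  qed (auto simp: contains_pattern_3 not_le)
  then show ?thesis
    unfolding avoids_def no_two_larger_before_def by blast
qed

lemma no_two_larger_before_Cons:
  "no_two_larger_before (x # \<pi>) \<longleftrightarrow> no_two_larger_before \<pi> \<and>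
     (\<forall>j k. j < k \<longrightarrow> k < length \<pi> \<longrightarrow> \<pi> ! k < x \<longrightarrow> \<not> \<pi> ! k < \<pi> ! j)"
  (is "?L \<longleftrightarrow> ?R")
proof
  assume L: ?L
  have "\<not> \<pi> ! k < \<pi> ! j" if "i < j" "j < k" "k < length \<pi>" "\<pi> ! k < \<pi> ! i" for i j k
    using L that unfolding no_two_larger_before_def
    by (metis Suc_less_eq length_Cons nth_Cons_Suc)
  moreover have "\<not> \<pi> ! k < \<pi> ! j" if "j < k" "k < length \<pi>" "\<pi> ! k < x" for j k
    using L that unfolding no_two_larger_before_def
    by (metis Suc_less_eq length_Cons nth_Cons_Suc nth_Cons_0 zero_less_Suc)
  ultimately show ?R
    by (auto simp: no_two_larger_before_def)
next
  assume ?R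
  then show ?L
    unfolding no_two_larger_before_def
    by (auto simp: nth_Cons split: nat.splits)
qed

lemma no_two_larger_before_Cons_le:
  assumes "\<forall>y\<in>set \<pi>. c \<le> y"
  shows "no_two_larger_before (c # \<pi>) \<longleftrightarrow> no_two_larger_before \<pi>"
  unfolding no_two_larger_before_Cons using assms by (meson leD nth_mem)

text \<open>In second place, \<open>c\<close> has only one entry before it, and being least it is
  never a larger entry before another one.\<close>

lemma no_two_larger_before_Cons_Cons_le:
  assumes "\<forall>y\<in>set \<pi>. c \<le> y"
  shows "no_two_larger_before (x # c # \<pi>) \<longleftrightarrow> no_two_larger_before (x # \<pi>)"
proof -
  have "(\<forall>j k. j < k \<longrightarrow> k < length (c # \<pi>) \<longrightarrow> (c # \<pi>) ! k < x \<longrightarrow> \<not> (c # \<pi>) ! k < (c # \<pi>) ! j) \<longleftrightarrow>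
      (\<forall>j k. j < k \<longrightarrow> k < length \<pi> \<longrightarrow> \<pi> ! k < x \<longrightarrow> \<not> \<pi> ! k < \<pi> ! j)" (is "?L \<longleftrightarrow> ?R")
  proof
    assume ?L
    then show ?R
      by (metis Suc_less_eq length_Cons nth_Cons_Suc)
  next
    assume ?R
    then show ?L
      using assms by (auto simp: nth_Cons leD split: nat.splits)
  qed
  then show ?thesis
    using assms by (simp only: no_two_larger_before_Cons[of x] no_two_larger_before_Cons_le)
qed

section \<open>Removing the least entry\<close>

text \<open>These are not the layered permutations of the literature, which avoid 231 and 312. The
  movable lower end \<open>c\<close> spares relabelling after the least entry is removed.\<close>

definition layered :: "nat \<Rightarrow> nat \<Rightarrow> nat list \<Rightarrow> bool" where
  "layered c m \<pi> \<longleftrightarrow> distinct \<pi> \<and> set \<pi> = {c..<c + m} \<and> no_two_larger_before \<pi>"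

lemma layered_0: "layered c 0 \<pi> \<longleftrightarrow> \<pi> = []"
  by (auto simp: layered_def no_two_larger_before_def)

lemma layered_least: "layered c (Suc m) \<pi> \<Longrightarrow> c \<in> set \<pi>"
  by (simp add: layered_def)

lemma layered_singleton: "layered c (Suc m) [x] \<Longrightarrow> x = c"
  using layered_least by fastforce

lemma layered_Suc_Nil: "\<not> layered c (Suc m) []"
  by (auto simp: layered_def)

lemma layered_Cons_least: "layered c (Suc m) (c # \<pi>) \<longleftrightarrow> layered (Suc c) m \<pi>"
proof -
  have "distinct (c # \<pi>) \<and> set (c # \<pi>) = {c..<c + Suc m} \<longleftrightarrow> distinct \<pi> \<and> set \<pi> = {Suc c..<Suc c + m}"
    (is "?L \<longleftrightarrow> ?R")
  proof -
    have "{c..<c + Suc m} = insert c {Suc c..<Suc c + m}" "c \<notin> {Suc c..<Suc c + m}"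
      by auto
    then show ?thesis
      by (metis distinct.simps(2) insert_ident list.simps(15))
  qed
  moreover have "no_two_larger_before (c # \<pi>) \<longleftrightarrow> no_two_larger_before \<pi>" if ?R
    using that by (intro no_two_larger_before_Cons_le) auto
  ultimately show ?thesis
    unfolding layered_def by blast
qed

lemma layered_Cons_ge: "layered c m (x # \<pi>) \<Longrightarrow> c \<le> x"
  unfolding layered_def by (metis atLeastLessThan_iff list.set_intros(1))

lemma layered_Suc_less: "layered (Suc c) m \<pi> \<Longrightarrow> \<forall>a\<in>set \<pi>. c < a"
  by (auto simp: layered_def)

text \<open>Otherwise \<open>c\<close> would occur later, with the two larger entries
  \<open>x\<close> and \<open>y\<close> before it.\<close>

lemma layered_Cons_Cons:
  assumes "c < x" "layered c m (x # y # \<pi>)"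
  shows "y = c"
proof (rule ccontr)
  assume "y \<noteq> c"
  have set: "set (x # y # \<pi>) = {c..<c + m}"
    using assms(2) by (simp add: layered_def)
  have "y \<in> {c..<c + m}"
    unfolding set[symmetric] by simp
  then have "c < y" "c \<in> set (x # y # \<pi>)"
    unfolding set using \<open>y \<noteq> c\<close> by auto
  with assms(1) obtain k where "k < length \<pi>" "\<pi> ! k = c"
    by (auto simp: in_set_conv_nth)
  moreover have "no_two_larger_before (x # y # \<pi>)"
    using assms(2) by (simp add: layered_def)
  ultimately show False
    using assms(1) \<open>c < y\<close> unfolding no_two_larger_before_def
    by (metis Suc_less_eq length_Cons nth_Cons_0 nth_Cons_Suc zero_less_Suc)
qed

text \<open>The least entry is harmless in either of the first two places, so \<open>x\<close> and
  \<open>c\<close> can be swapped and \<open>c\<close> then removed from the front.\<close>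

lemma layered_Cons_least_Cons:
  assumes "c < x"
  shows "layered c (Suc m) (x # c # \<pi>) \<longleftrightarrow> layered (Suc c) m (x # \<pi>)"
proof -
  have "layered c (Suc m) (x # c # \<pi>) \<longleftrightarrow> layered c (Suc m) (c # x # \<pi>)"
  proof -
    have "no_two_larger_before (x # c # \<pi>) \<longleftrightarrow> no_two_larger_before (c # x # \<pi>)"
      if "set (c # x # \<pi>) = {c..<c + Suc m}"
    proof -
      have le: "\<forall>y\<in>set (c # x # \<pi>). c \<le> y"
        using that by (metis atLeastLessThan_iff)
      then show ?thesis
        by (simp add: no_two_larger_before_Cons_le no_two_larger_before_Cons_Cons_le)
    qed
    moreover have "distinct (x # c # \<pi>) \<longleftrightarrow> distinct (c # x # \<pi>)" "set (x # c # \<pi>) = set (c # x # \<pi>)"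
      by auto
    ultimately show ?thesis
      unfolding layered_def by metis
  qed
  then show ?thesis
    by (simp only: layered_Cons_least)
qed

section \<open>Completions of labelled paths\<close>

text \<open>\<open>h\<close> is the height above the diagonal, which is all that a suffix of a path
  needs to know about its past.\<close>

fun descends :: "nat \<Rightarrow> lstep list \<Rightarrow> bool" where
  "descends h [] \<longleftrightarrow> h = 0"
| "descends h (LNorth a # w) \<longleftrightarrow> descends (Suc h) w"
| "descends h (LEast # w) \<longleftrightarrow> 0 < h \<and> descends (h - 1) w"

text \<open>The start \<open>(x, x + h)\<close> is an arbitrary point at height \<open>h\<close>;
  \<open>x\<close> must vary because an east step increases it.\<close>

lemma descends_iff:
  "descends h w \<longleftrightarrow>
    (let z = fold move (map step_of w) (x, x + h) in fst z = snd z) \<and>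
    (\<forall>k \<le> length w. let z = fold move (take k (map step_of w)) (x, x + h) in fst z \<le> snd z)"
proof (induction h w arbitrary: x rule: descends.induct)
  case (2 h a w)
  show ?case
    \<comment> \<open>With the bound in the form \<open>k < Suc _\<close>,
      \<open>All_less_Suc2\<close> splits off the empty prefix.\<close>
    using 2[of x] by (simp add: Let_def flip: less_Suc_eq_le) (subst All_less_Suc2, simp)
next
  case (3 h w)
  show ?case
  proof (cases h)
    case 0
    have "\<exists>k \<le> length (LEast # w). \<not> fst (fold move (take k (map step_of (LEast # w))) (x, x + h))
        \<le> snd (fold move (take k (map step_of (LEast # w))) (x, x + h))"
      by (intro exI[of _ 1]) (simp add: 0)
    then show ?thesis
      by (auto simp: 0 Let_def)
  next
    case (Suc g)
    then show ?thesis
      using 3[of "Suc x"] by (simp add: Let_def flip: less_Suc_eq_le) (subst All_less_Suc2, simp)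
  qed
qed (auto simp: Let_def)

lemma snd_fold_move: "snd (fold move (map step_of w) z) = snd z + length (phi w)"
proof (induction w arbitrary: z)
  case (Cons s w)
  then show ?case by (cases s; cases z) simp_all
qed simp

text \<open>There are \<open>n\<close> north steps, so ending on the diagonal already means ending
  at \<open>(n, n)\<close>.\<close>

lemma dyck_path_iff_descends:
  assumes "length (phi p) = n"
  shows "dyck_path n (map step_of p) \<longleftrightarrow> descends 0 p"
proof -
  have "endpoint (map step_of p) = (n, n) \<longleftrightarrow>
      fst (endpoint (map step_of p)) = snd (endpoint (map step_of p))"
    using snd_fold_move[of p "(0, 0)"] assms by (auto simp: endpoint_def prod_eq_iff)
  then show ?thesis
    unfolding dyck_path_def descends_iff[of 0 p 0] by (simp add: endpoint_def Let_def)
qed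

definition runs_increase :: "lstep list \<Rightarrow> bool" where
  "runs_increase = successively (\<lambda>s t. \<forall>a b. s = LNorth a \<longrightarrow> t = LNorth b \<longrightarrow> a < b)"

lemma runs_increase_simps [simp]:
  "runs_increase []"
  "runs_increase (LEast # w) \<longleftrightarrow> runs_increase w"
  "runs_increase (LNorth a # LEast # w) \<longleftrightarrow> runs_increase w"
  "runs_increase (LNorth a # LNorth b # w) \<longleftrightarrow> a < b \<and> runs_increase (LNorth b # w)"
  by (auto simp: runs_increase_def successively_Cons)

lemma runs_increase_Cons_less:
  assumes "\<forall>a\<in>set (phi w). c < a"
  shows "runs_increase (LNorth c # w) \<longleftrightarrow> runs_increase w"
proof (cases w)
  case (Cons s v)
  then show ?thesis
    using assms by (cases s) auto
qed (simp add: runs_increase_def)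

text \<open>In \<open>completions\<close> the labels still to be read are \<open>{c..<c + m}\<close>; in
  \<open>open_completions\<close> they are \<open>{c..c + m}\<close> without the already read label \<open>d\<close>, and
  \<open>d\<close> is not the label of the step immediately before \<open>w\<close>.\<close>

definition completions :: "nat \<Rightarrow> nat \<Rightarrow> nat \<Rightarrow> lstep list set" where
  "completions c h m = {w. descends h w \<and> runs_increase w \<and> layered c m (phi w)}"

definition open_completions :: "nat \<Rightarrow> nat \<Rightarrow> nat \<Rightarrow> (nat \<times> lstep list) set" where
  "open_completions c h m =
     {(d, w). c < d \<and> descends h w \<and> runs_increase w \<and> layered c (Suc m) (d # phi w)}"

lemma completions_0: "completions c h 0 = {replicate h LEast}"
proof -
  have "descends h w \<and> runs_increase w \<and> phi w = [] \<longleftrightarrow> w = replicate h LEast" for w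
    by (induction h w rule: descends.induct) (auto simp: gr0_conv_Suc Cons_replicate_eq)
  then show ?thesis
    by (auto simp: completions_def layered_0)
qed

lemma open_completions_0: "open_completions c h 0 = {}"
proof -
  have False if "c < d" "layered c (Suc 0) (d # \<pi>)" for d \<pi>
    using that by (auto simp: layered_def)
  then show ?thesis
    by (auto simp: open_completions_def)
qed

text \<open>The first step is east, or carries \<open>c\<close>, or carries some
  \<open>d > c\<close>. In the last case the next label must be \<open>c\<close>; a north step there
  would break the increasing run, so an east step intervenes and the height returns to
  \<open>h\<close>.\<close>

lemma completions_Suc:
  "completions c h (Suc m) =
     Cons LEast ` (if h = 0 then {} else completions c (h - 1) (Suc m)) \<union>
     (Cons (LNorth c) ` completions (Suc c) (Suc h) m \<union>
      (\<lambda>(d, w). LNorth d # LEast # w) ` open_completions c h m)" (is "?L = ?R")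
proof (rule set_eqI)
  fix w
  show "w \<in> ?L \<longleftrightarrow> w \<in> ?R"
  proof (cases w)
    case Nil
    then show ?thesis by (auto simp: completions_def layered_Suc_Nil)
  next
    case w: (Cons s v)
    show ?thesis
    proof (cases s)
      case LEast
      then show ?thesis by (auto simp: w completions_def)
    next
      case (LNorth x)
      show ?thesis
      proof (cases "x = c")
        case True
        have "w \<in> ?L \<longleftrightarrow> v \<in> completions (Suc c) (Suc h) m"
          using runs_increase_Cons_less[of v c] layered_Suc_less[of c m "phi v"]
          by (auto simp: w LNorth True completions_def layered_Cons_least)
        then show ?thesis
          by (auto simp: w LNorth True open_completions_def)
      next
        case False
        show ?thesis
        proof (cases v)
          case Nil
          then show ?thesis
            using False layered_singleton[of c m x]
            by (auto simp: w LNorth completions_def)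
        next
          case v: (Cons t u)
          show ?thesis
          proof (cases t)
            case (LNorth y)
            then show ?thesis
              using False \<open>s = LNorth x\<close> layered_Cons_Cons[of c x "Suc m" y "phi u"]
                layered_Cons_ge[of c "Suc m" x "y # phi u"]
              by (auto simp: w v completions_def)
          next
            case LEast
            then show ?thesis
              using False \<open>s = LNorth x\<close> layered_Cons_ge[of c "Suc m" x "phi u"]
              by (auto simp: w v completions_def open_completions_def image_iff)
          qed
        qed
      qed
    qed
  qed
qed

text \<open>A north step must carry \<open>c\<close>, since \<open>d\<close> is already one larger
  label before it. Afterwards either \<open>d = Suc c\<close> and no read label exceeds an unread
  one, or \<open>d\<close> stays open above \<open>Suc c\<close>.\<close>

lemma open_completions_Suc:
  "open_completions c h (Suc m) =
     (\<lambda>(d, w). (d, LEast # w)) ` (if h = 0 then {} else open_completions c (h - 1) (Suc m)) \<union>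
     ((\<lambda>w. (Suc c, LNorth c # w)) ` completions (Suc (Suc c)) (Suc h) m \<union>
      (\<lambda>(d, w). (d, LNorth c # w)) ` open_completions (Suc c) (Suc h) m)" (is "?L = ?R")
proof (rule set_eqI)
  fix z :: "nat \<times> lstep list"
  obtain d w where z: "z = (d, w)" by fastforce
  show "z \<in> ?L \<longleftrightarrow> z \<in> ?R"
  proof (cases w)
    case Nil
    then show ?thesis
      using layered_singleton[of c "Suc m" d]
      by (auto simp: z open_completions_def)
  next
    case w: (Cons s v)
    show ?thesis
    proof (cases s)
      case LEast
      then show ?thesis by (auto simp: z w open_completions_def image_iff)
    next
      case (LNorth x)
      show ?thesis
      proof (cases "x = c")
        case False
        then show ?thesis
          using layered_Cons_Cons[of c d "Suc (Suc m)" x "phi v"]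
          by (auto simp: z w LNorth open_completions_def)
      next
        case True
        have less: "\<forall>a\<in>set (phi v). c < a" if "layered (Suc c) (Suc m) (d # phi v)"
          using layered_Suc_less[OF that] by simp
        have "z \<in> ?L \<longleftrightarrow> c < d \<and> descends (Suc h) v \<and> runs_increase v \<and> layered (Suc c) (Suc m) (d # phi v)"
          using runs_increase_Cons_less[of v c] less layered_Cons_least_Cons[of c d "Suc m" "phi v"]
          by (auto simp: z w LNorth True open_completions_def)
        also have "\<dots> \<longleftrightarrow> d = Suc c \<and> v \<in> completions (Suc (Suc c)) (Suc h) m \<or>
            (d, v) \<in> open_completions (Suc c) (Suc h) m"
          using layered_Cons_ge[of "Suc c" "Suc m" d "phi v"]
          by (cases "d = Suc c") (auto simp: completions_def open_completions_def layered_Cons_least)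
        also have "\<dots> \<longleftrightarrow> z \<in> ?R"
          by (auto simp: z w LNorth True image_iff)
        finally show ?thesis .
      qed
    qed
  qed
qed

section \<open>Counting completions by ballot numbers\<close>

text \<open>The numbers depend only on the height and on \<open>m\<close>, so the least unread label
  is no argument. At height 0 the summand for an east step is absent.\<close>

fun closed_count open_count :: "nat \<Rightarrow> nat \<Rightarrow> nat" where
  "closed_count h 0 = 1"
| "open_count h 0 = 0"
| "closed_count 0 (Suc m) = closed_count 1 m + open_count 0 m"
| "closed_count (Suc h) (Suc m) =
     closed_count h (Suc m) + (closed_count (Suc (Suc h)) m + open_count (Suc h) m)"
| "open_count 0 (Suc m) = closed_count 1 m + open_count 1 m"
| "open_count (Suc h) (Suc m) =
     open_count h (Suc m) + (closed_count (Suc (Suc h)) m + open_count (Suc (Suc h)) m)"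

lemma finite_card_Un_images:
  assumes "finite X \<and> card X = x" "finite Y \<and> card Y = y" "finite Z \<and> card Z = z"
    and "inj f" "inj g" "inj k"
    and "f ` X \<inter> (g ` Y \<union> k ` Z) = {}" "g ` Y \<inter> k ` Z = {}"
  shows "finite (f ` X \<union> (g ` Y \<union> k ` Z)) \<and> card (f ` X \<union> (g ` Y \<union> k ` Z)) = x + (y + z)"
proof -
  have "inj_on f X" "inj_on g Y" "inj_on k Z"
    using assms(4-6) by (auto intro: inj_on_subset)
  then show ?thesis
    using assms by (simp add: card_Un_disjoint card_image)
qed

lemma finite_card_completions_Suc:
  assumes "h = 0 \<and> x = 0 \<or>
      h \<noteq> 0 \<and> finite (completions c (h - 1) (Suc m)) \<and> card (completions c (h - 1) (Suc m)) = x"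
    and "finite (completions (Suc c) (Suc h) m) \<and> card (completions (Suc c) (Suc h) m) = y"
    and "finite (open_completions c h m) \<and> card (open_completions c h m) = z"
  shows "finite (completions c h (Suc m)) \<and> card (completions c h (Suc m)) = x + (y + z)"
  unfolding completions_Suc[of c h m]
proof (rule finite_card_Un_images[OF _ assms(2,3)])
  show "Cons (LNorth c) ` completions (Suc c) (Suc h) m \<inter>
      (\<lambda>(d, w). LNorth d # LEast # w) ` open_completions c h m = {}"
    by (auto simp: open_completions_def)
qed (use assms(1) in \<open>auto simp: inj_def\<close>)

lemma finite_card_open_completions_Suc:
  assumes "h = 0 \<and> x = 0 \<or>
      h \<noteq> 0 \<and> finite (open_completions c (h - 1) (Suc m)) \<and> card (open_completions c (h - 1) (Suc m)) = x"
    and "finite (completions (Suc (Suc c)) (Suc h) m) \<and> card (completions (Suc (Suc c)) (Suc h) m) = y"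
    and "finite (open_completions (Suc c) (Suc h) m) \<and> card (open_completions (Suc c) (Suc h) m) = z"
  shows "finite (open_completions c h (Suc m)) \<and> card (open_completions c h (Suc m)) = x + (y + z)"
  unfolding open_completions_Suc[of c h m]
proof (rule finite_card_Un_images[OF _ assms(2,3)])
  show "(\<lambda>w. (Suc c, LNorth c # w)) ` completions (Suc (Suc c)) (Suc h) m \<inter>
      (\<lambda>(d, w). (d, LNorth c # w)) ` open_completions (Suc c) (Suc h) m = {}"
    by (auto simp: open_completions_def)
qed (use assms(1) in \<open>auto simp: inj_def\<close>)

lemma card_completions:
  "finite (completions c h m) \<and> card (completions c h m) = closed_count h m"
  "finite (open_completions c h m) \<and> card (open_completions c h m) = open_count h m"
proof (induction m arbitrary: c h)
  case 0
  show "finite (completions c h 0) \<and> card (completions c h 0) = closed_count h 0" for c h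
    by (simp add: completions_0)
  show "finite (open_completions c h 0) \<and> card (open_completions c h 0) = open_count h 0" for c h
    by (simp add: open_completions_0)
next
  case (Suc m)
  note IH = Suc.IH
  show "finite (completions c h (Suc m)) \<and> card (completions c h (Suc m)) = closed_count h (Suc m)" for c h
  \<comment> \<open>An east step lowers the height but keeps the number of labels, hence an inner
    induction.\<close>
  proof (induction h)
    case 0
    show ?case
      using finite_card_completions_Suc[of 0 0 c m] IH by simp
  next
    case (Suc h)
    then show ?case
      using finite_card_completions_Suc[of "Suc h" _ c m] IH
      by simp
  qed
  show "finite (open_completions c h (Suc m)) \<and> card (open_completions c h (Suc m)) = open_count h (Suc m)" for c h
  proof (induction h)
    case 0
    show ?case
      using finite_card_open_completions_Suc[of 0 0 c m] IH by simp
  next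
    case (Suc h)
    then show ?case
      using finite_card_open_completions_Suc[of "Suc h" _ c m] IH
      by simp
  qed
qed

text \<open>The two sums alternate as the exponent of \<open>T\<close> grows by one. Passing from
  each sum to the next changes a single summand, by exactly the term \<open>x T^(k+3)\<close> of the
  power recursion.\<close>

lemma count_eq_raney:
  "closed_count (Suc h) m + open_count h m = raney (2 * h + 3) m"
  "closed_count (Suc h) m + open_count (Suc h) m = raney (2 * h + 4) m"
proof (induction m arbitrary: h)
  case (Suc m)
  note IH = Suc.IH
  have raney_step: "raney (k + 4) (Suc m) = raney (k + 3) (Suc m) + raney (k + 6) m" for k
    by (simp add: raney.simps(3) numeral_eq_Suc)
  show 1: "closed_count (Suc h) (Suc m) + open_count h (Suc m) = raney (2 * h + 3) (Suc m)" for h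
  proof (induction h)
    case 0
    have "raney 3 (Suc m) = raney 3 m + raney 4 m + raney 5 m"
      by (simp add: raney.simps(3) numeral_eq_Suc)
    then show ?case
      using IH(1)[of 0] IH(2)[of 0] IH(1)[of 1] by simp
  next
    case (Suc h)
    then show ?case
      using IH(1)[of "Suc (Suc h)"] IH(2)[of "Suc h"]
        raney_step[of "2 * h"] raney_step[of "2 * h + 1"]
      by (simp add: ac_simps)
  qed
  show "closed_count (Suc h) (Suc m) + open_count (Suc h) (Suc m) = raney (2 * h + 4) (Suc m)" for h
    using 1[of h] IH(2)[of "Suc h"] raney_step[of "2 * h"] by (simp add: ac_simps)
qed simp_all

text \<open>For positive \<open>n\<close>, both sides equal \<open>raney 3 (n - 1)\<close>, which
  reflects \<open>T = 1 + x T^3\<close>.\<close>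

lemma closed_count_0: "closed_count 0 n = raney 1 n"
  using count_eq_raney(1)[of 0] by (cases n) (simp_all add: raney.simps(3))

section \<open>Parking functions as completions of the empty path\<close>

lemma parking_functions_avoiding_eq:
  "{p. parking_function n p \<and> (\<forall>\<rho>\<in>{[2, 3, 1], [3, 2, 1]}. avoids (phi p) \<rho>)} = completions 1 0 n"
proof -
  have "parking_function n p \<and> avoids (phi p) [2, 3, 1] \<and> avoids (phi p) [3, 2, 1] \<longleftrightarrow>
    p \<in> completions 1 0 n" for p
  proof -
    have perm: "phi p \<in> permutations_of_set {1..n} \<longleftrightarrow> distinct (phi p) \<and> set (phi p) = {1..<1 + n}"
      by (auto simp: permutations_of_set_def atLeastLessThanSuc_atLeastAtMost)
    have runs: "(\<forall>i a b. Suc i < length p \<longrightarrow> p ! i = LNorth a \<longrightarrow> p ! Suc i = LNorth b \<longrightarrow> a < b)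
        \<longleftrightarrow> runs_increase p"
      by (auto simp: runs_increase_def successively_conv_nth)
    show ?thesis
    \<comment> \<open>Both sides require this condition, and it supplies the number of north steps
      and the distinctness on which the two characterizations rest.\<close>
    proof (cases "distinct (phi p) \<and> set (phi p) = {1..<1 + n}")
      case True
      then have "length (phi p) = n"
        using distinct_card[of "phi p"] by simp
      then show ?thesis
        using True dyck_path_iff_descends[of p n] avoids_231_321_iff[of "phi p"]
        unfolding parking_function_def perm runs completions_def layered_def by auto
    next
      case False
      then show ?thesis
        unfolding parking_function_def perm completions_def layered_def by auto
    qed
  qed
  then show ?thesis
    by auto
qed

theorem theorem27:
  fixes n :: nat
  assumes "n \<ge> 1"
  shows "real (pf n {[2, 3, 1], [3, 2, 1]}) = real ((3 * n) choose n) / real (2 * n + 1)"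
proof -
  have "pf n {[2, 3, 1], [3, 2, 1]} = raney 1 n"
    unfolding pf_def parking_functions_avoiding_eq using card_completions(1) closed_count_0 by simp
  then show ?thesis
    using raney_1[of n] by (simp add: field_simps flip: of_nat_mult of_nat_add of_nat_Suc)
qed

end
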